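(* Let $\theta=\{\theta_k\}_{k\in\mathbb Z}$ be a sequence in $\mathcal S(p,\omega)$ for some $p\in\mathbb N$ and $\omega>0$, and let $\phi\in\mathcal{BPC}(\theta)$ be an asymptotically unpredictable function with values in $\mathbb R^m$. Then, for every $c\in\mathbb R^m$ and for every non-singular matrix $\Omega\in\mathbb R^{m\times m}$, the function $\widetilde\phi\in\mathcal{BPC}(\theta)$ defined by $\widetilde\phi(t)=\Omega\phi(t)+c$ is also asymptotically unpredictable.
   Context: Vectors carry the Euclidean norm and square matrices the spectral norm. $\mathcal S(p,\omega)$ is the set of strictly increasing real sequences $\theta=\{\theta_k\}_{k\in\mathbb Z}$ with $\theta_{k+p}=\theta_k+\omega$ for all $k\in\mathbb Z$ ($p\in\mathbb N$, $\omega>0$). $\mathcal{BPC}(\theta)$ is the set of bounded functions $\varphi:\mathbb R\to\mathbb R^m$ such that for each $k\in\mathbb Z$: $\varphi$ is continuous on $(\theta_{k-1},\theta_k)$, the right limit $\varphi(\theta_k+)=\lim_{t\to\theta_k^+}\varphi(t)$ exists, and $\varphi(\theta_k)=\lim_{t\to\theta_k^-}\varphi(t)$. Unpredictable function: $\psi\in\mathcal{BPC}(\theta)$, with $\theta\in\mathcal S(p,\omega)$, is unpredictable if there exist positive numbers $\varepsilon_0,\nu$ and real sequences $\{\mu_n\}_{n\in\mathbb N}$, $\{\tau_n\}_{n\in\mathbb N}$, both diverging to infinity, such that (i) for every $\varepsilon>0$ there is $\delta>0$ with $\|\psi(s_1)-\psi(s_2)\|<\varepsilon$ whenever $s_1,s_2$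 belong to the same interval of continuity (one of the intervals determined by consecutive $\theta_{k-1},\theta_k$) and $|s_1-s_2|<\delta$; (ii) $\|\psi(t+\mu_n)-\psi(t)\|\to0$ as $n\to\infty$ uniformly on compact subsets of $\mathbb R$; (iii) $\|\psi(t+\mu_n)-\psi(t)\|\ge\varepsilon_0$ for each $t\in[\tau_n-\nu,\tau_n+\nu]$ and $n\in\mathbb N$. Asymptotically unpredictable function: $\phi\in\mathcal{BPC}(\theta)$, with $\theta\in\mathcal S(p,\omega)$, is asymptotically unpredictable if $\phi(t)=\psi(t)+\xi(t)$ for all $t\in\mathbb R$, for some unpredictable $\psi\in\mathcal{BPC}(\theta)$ and some $\xi\in\mathcal{BPC}(\theta)$ with $\|\xi(t)\|\to0$ as $t\to\infty$. *)

theory Defs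
  imports "HOL-Analysis.Analysis"
begin

definition periodic_seqs :: "nat \<Rightarrow> real \<Rightarrow> (int \<Rightarrow> real) set" where
  "periodic_seqs p \<omega> = {\<theta>. strict_mono \<theta> \<and> (\<forall>k. \<theta> (k + int p) = \<theta> k + \<omega>)}"

definition BPC :: "(int \<Rightarrow> real) \<Rightarrow> (real \<Rightarrow> real ^ 'm) set" where
  "BPC \<theta> = {\<phi>. bounded (range \<phi>) \<and>
     (\<forall>k. continuous_on {\<theta> (k - 1)<..<\<theta> k} \<phi> \<and>
          (\<exists>L. (\<phi> \<longlongrightarrow> L) (at_right (\<theta> k))) \<and>
          (\<phi> \<longlongrightarrow> \<phi> (\<theta> k)) (at_left (\<theta> k)))}"

(* The functions in BPC are left-continuous at the points \<theta> k, so the intervals of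
   continuity are taken half-open; they then partition the real line.  For functions in
   BPC, using the open intervals in the first condition below gives an equivalent notion. *)
definition unpredictable :: "(int \<Rightarrow> real) \<Rightarrow> (real \<Rightarrow> real ^ 'm) \<Rightarrow> bool" where
  "unpredictable \<theta> \<psi> \<longleftrightarrow>
     (\<exists>p \<omega>. p \<ge> 1 \<and> \<omega> > 0 \<and> \<theta> \<in> periodic_seqs p \<omega>) \<and> \<psi> \<in> BPC \<theta> \<and>
     (\<exists>\<epsilon>\<^sub>0 \<nu> (\<mu> :: nat \<Rightarrow> real) (\<tau> :: nat \<Rightarrow> real).
        \<epsilon>\<^sub>0 > 0 \<and> \<nu> > 0 \<and>
        filterlim \<mu> at_top sequentially \<and> filterlim \<tau> at_top sequentially \<and>
        (\<forall>\<epsilon>>0. \<exists>\<delta>>0. \<forall>k. \<forall>s\<^sub>1\<in>{\<theta> (k - 1)<..\<theta> k}. \<forall>s\<^sub>2\<in>{\<theta> (k - 1)<..\<theta> k}.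
           \<bar>s\<^sub>1 - s\<^sub>2\<bar> < \<delta> \<longrightarrow> norm (\<psi> s\<^sub>1 - \<psi> s\<^sub>2) < \<epsilon>) \<and>
        (\<forall>K. compact K \<longrightarrow>
           uniform_limit K (\<lambda>n t. norm (\<psi> (t + \<mu> n) - \<psi> t)) (\<lambda>_. 0) sequentially) \<and>
        (\<forall>n. \<forall>t\<in>{\<tau> n - \<nu>..\<tau> n + \<nu>}. norm (\<psi> (t + \<mu> n) - \<psi> t) \<ge> \<epsilon>\<^sub>0))"

definition asymptotically_unpredictable :: "(int \<Rightarrow> real) \<Rightarrow> (real \<Rightarrow> real ^ 'm) \<Rightarrow> bool" where
  "asymptotically_unpredictable \<theta> \<phi> \<longleftrightarrow>
     (\<exists>p \<omega>. p \<ge> 1 \<and> \<omega> > 0 \<and> \<theta> \<in> periodic_seqs p \<omega>) \<and> \<phi> \<in> BPC \<theta> \<and>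
     (\<exists>\<psi> \<xi>. unpredictable \<theta> \<psi> \<and> \<xi> \<in> BPC \<theta> \<and>
        ((\<lambda>t. norm (\<xi> t)) \<longlongrightarrow> 0) at_top \<and> (\<forall>t. \<phi> t = \<psi> t + \<xi> t))"

end

theory Submission
  imports Defs
begin

text \<open>An injective linear map \<open>f\<close> on a finite-dimensional space distorts norms by
  bounded factors: b * |x| \<le> |f x| \<le> B * |x| with b, B > 0. Increments of f(\<psi>) + c are
  the images under \<open>f\<close> of increments of \<psi>. Hence the upper bound transports
  everything that asks increments to be small (uniform continuity on the intervals, recurrence along
  \<mu>), and the lower bound transports the separation near the points of \<tau>; this is
  \<open>unpredictable_affine\<close>. The asymptotic version follows by applying the affine map to
  the unpredictable part and only \<open>f\<close> to the vanishing part. Non-singularity of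
  \<Omega> enters as injectivity of x \<mapsto> \<Omega> x.\<close>

lemma BPC_affine:
  fixes f :: "real ^ 'm \<Rightarrow> real ^ 'n"
  assumes f: "bounded_linear f" and \<phi>: "\<phi> \<in> BPC \<theta>"
  shows "(\<lambda>t. f (\<phi> t) + c) \<in> BPC \<theta>"
proof -
  interpret bounded_linear f by (fact f)
  have "bounded ((\<lambda>y. c + y) ` f ` range \<phi>)"
    using \<phi> bounded_linear_image[OF _ f] by (intro bounded_translation) (auto simp: BPC_def)
  moreover have "(\<lambda>y. c + y) ` f ` range \<phi> = range (\<lambda>t. f (\<phi> t) + c)"
    by (simp add: image_image add.commute)
  ultimately have "bounded (range (\<lambda>t. f (\<phi> t) + c))"
    by simp
  moreover have "continuous_on {\<theta> (k - 1)<..<\<theta> k} (\<lambda>t. f (\<phi> t) + c)" for k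
    using \<phi> by (intro continuous_on_add continuous_on continuous_on_const) (auto simp: BPC_def)
  moreover have "\<exists>L. ((\<lambda>t. f (\<phi> t) + c) \<longlongrightarrow> L) (at_right (\<theta> k))" for k
  proof -
    obtain L where "(\<phi> \<longlongrightarrow> L) (at_right (\<theta> k))"
      using \<phi> by (auto simp: BPC_def)
    then have "((\<lambda>t. f (\<phi> t) + c) \<longlongrightarrow> f L + c) (at_right (\<theta> k))"
      by (intro tendsto_intros tendsto)
    then show ?thesis ..
  qed
  moreover have "((\<lambda>t. f (\<phi> t) + c) \<longlongrightarrow> f (\<phi> (\<theta> k)) + c) (at_left (\<theta> k))" for k
    using \<phi> by (intro tendsto_intros tendsto) (auto simp: BPC_def)
  ultimately show ?thesis
    by (simp add: BPC_def)
qed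

text \<open>The sequences \<mu>, \<tau> and the radius \<nu> of \<psi> serve again; only the
  separation constant changes, from \<open>\<epsilon>\<^sub>0\<close> to
  \<open>b * \<epsilon>\<^sub>0\<close>, where \<open>b\<close> is a lower bound for the stretching
  by \<open>f\<close>.\<close>

lemma unpredictable_affine:
  fixes f :: "real ^ 'm \<Rightarrow> real ^ 'n"
  assumes f: "bounded_linear f" and "inj f" and \<psi>: "unpredictable \<theta> \<psi>"
  shows "unpredictable \<theta> (\<lambda>t. f (\<psi> t) + c)"
proof -
  interpret bounded_linear f by (fact f)
  obtain B where "B > 0" and upper: "\<And>x. norm (f x) \<le> norm x * B"
    using pos_bounded by blast
  \<comment> \<open>The constant comes from injectivity in finite dimension: |f x| has a positive
    minimum on the unit sphere.\<close>
  obtain b where "b > 0" and lower: "\<And>x. b * norm x \<le> norm (f x)"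
    using linear_inj_bounded_below_pos[OF linear_axioms \<open>inj f\<close>] by blast
  obtain \<epsilon>\<^sub>0 \<nu> \<mu> \<tau> where
        sep: "\<forall>n. \<forall>t\<in>{\<tau> n - \<nu>..\<tau> n + \<nu>}. norm (\<psi> (t + \<mu> n) - \<psi> t) \<ge> \<epsilon>\<^sub>0"
    and "\<epsilon>\<^sub>0 > 0" "\<nu> > 0"
    and lim: "filterlim \<mu> at_top sequentially" "filterlim \<tau> at_top sequentially"
    and uc: "\<forall>\<epsilon>>0. \<exists>\<delta>>0. \<forall>k. \<forall>s\<^sub>1\<in>{\<theta> (k - 1)<..\<theta> k}. \<forall>s\<^sub>2\<in>{\<theta> (k - 1)<..\<theta> k}.
           \<bar>s\<^sub>1 - s\<^sub>2\<bar> < \<delta> \<longrightarrow> norm (\<psi> s\<^sub>1 - \<psi> s\<^sub>2) < \<epsilon>"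
    and recur: "\<forall>K. compact K \<longrightarrow>
           uniform_limit K (\<lambda>n t. norm (\<psi> (t + \<mu> n) - \<psi> t)) (\<lambda>_. 0) sequentially"
    using \<psi> unfolding unpredictable_def by (elim exE conjE) (rule that)
  \<comment> \<open>The translation cancels in differences, so each condition below is proved for
    \<open>f\<close> of an increment of \<psi> and matched with the definition by this
    identity.\<close>
  have shift: "f x + c - (f y + c) = f (x - y)" for x y
    by (simp add: diff)
  \<comment> \<open>Asking \<psi> for tolerance \<epsilon> / B yields tolerance \<epsilon> after
    \<open>f\<close>. Both the uniform continuity and the recurrence use this rescaling.\<close>
  have small: "norm (f x) < \<epsilon>" if "norm x < \<epsilon> / B" for x \<epsilon>
    using upper[of x] that \<open>B > 0\<close> by (simp add: pos_less_divide_eq)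
  have "\<exists>\<delta>>0. \<forall>k. \<forall>s\<^sub>1\<in>{\<theta> (k - 1)<..\<theta> k}. \<forall>s\<^sub>2\<in>{\<theta> (k - 1)<..\<theta> k}.
           \<bar>s\<^sub>1 - s\<^sub>2\<bar> < \<delta> \<longrightarrow> norm (f (\<psi> s\<^sub>1 - \<psi> s\<^sub>2)) < \<epsilon>" if "\<epsilon> > 0" for \<epsilon>
  proof -
    have "\<epsilon> / B > 0"
      using that \<open>B > 0\<close> by simp
    from uc[rule_format, OF this] show ?thesis
      using small by blast
  qed
  moreover have "uniform_limit K (\<lambda>n t. norm (f (\<psi> (t + \<mu> n) - \<psi> t))) (\<lambda>_. 0) sequentially"
    if "compact K" for K
  proof (rule uniform_limitI)
    fix \<epsilon> :: real
    assume "\<epsilon> > 0"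
    with \<open>B > 0\<close> uniform_limitD[OF recur[rule_format, OF that], of "\<epsilon> / B"]
    have "\<forall>\<^sub>F n in sequentially. \<forall>t\<in>K. norm (\<psi> (t + \<mu> n) - \<psi> t) < \<epsilon> / B"
      by simp
    then show "\<forall>\<^sub>F n in sequentially. \<forall>t\<in>K. dist (norm (f (\<psi> (t + \<mu> n) - \<psi> t))) 0 < \<epsilon>"
      by eventually_elim (use small in simp)
  qed
  moreover have "norm (f (\<psi> (t + \<mu> n) - \<psi> t)) \<ge> b * \<epsilon>\<^sub>0" if "t \<in> {\<tau> n - \<nu>..\<tau> n + \<nu>}" for n t
  proof -
    have "b * \<epsilon>\<^sub>0 \<le> b * norm (\<psi> (t + \<mu> n) - \<psi> t)"
      using sep that \<open>b > 0\<close> by simp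
    also have "\<dots> \<le> norm (f (\<psi> (t + \<mu> n) - \<psi> t))"
      by (rule lower)
    finally show ?thesis .
  qed
  moreover have "b * \<epsilon>\<^sub>0 > 0"
    using \<open>b > 0\<close> \<open>\<epsilon>\<^sub>0 > 0\<close> by simp
  moreover have "(\<lambda>t. f (\<psi> t) + c) \<in> BPC \<theta>"
    using \<psi> BPC_affine[OF f] by (simp add: unpredictable_def)
  moreover have "\<exists>p \<omega>. p \<ge> 1 \<and> \<omega> > 0 \<and> \<theta> \<in> periodic_seqs p \<omega>"
    using \<psi> by (simp add: unpredictable_def)
  ultimately show ?thesis
    using lim \<open>\<nu> > 0\<close> unfolding unpredictable_def shift
    by (intro conjI exI[of _ "b * \<epsilon>\<^sub>0"] exI[of _ \<nu>] exI[of _ \<mu>] exI[of _ \<tau>]) simp_all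
qed

text \<open>Linearity splits the image as (f(\<psi>) + c) + f(\<xi>). The constant must go with the
  unpredictable part, since f(\<xi>) + c tends to c rather than to 0.\<close>

lemma asymptotically_unpredictable_affine:
  fixes f :: "real ^ 'm \<Rightarrow> real ^ 'n"
  assumes f: "bounded_linear f" and "inj f" and \<phi>: "asymptotically_unpredictable \<theta> \<phi>"
  shows "asymptotically_unpredictable \<theta> (\<lambda>t. f (\<phi> t) + c)"
proof -
  interpret bounded_linear f by (fact f)
  obtain \<psi> \<xi> where \<psi>: "unpredictable \<theta> \<psi>" and \<xi>: "\<xi> \<in> BPC \<theta>"
    and lim: "((\<lambda>t. norm (\<xi> t)) \<longlongrightarrow> 0) at_top" and eq: "\<And>t. \<phi> t = \<psi> t + \<xi> t"
    using \<phi> unfolding asymptotically_unpredictable_def by blast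
  have "unpredictable \<theta> (\<lambda>t. f (\<psi> t) + c)"
    using unpredictable_affine[OF f \<open>inj f\<close> \<psi>] .
  moreover have "(\<lambda>t. f (\<xi> t)) \<in> BPC \<theta>"
    using BPC_affine[OF f \<xi>, of 0] by simp
  \<comment> \<open>A bounded linear map sends functions tending to 0 to functions tending to 0; the
    norms are removed from the hypothesis and restored in the conclusion.\<close>
  moreover have "((\<lambda>t. norm (f (\<xi> t))) \<longlongrightarrow> 0) at_top"
    using lim by (intro tendsto_norm_zero tendsto_zero) (simp add: tendsto_norm_zero_iff)
  moreover have "f (\<phi> t) + c = (f (\<psi> t) + c) + f (\<xi> t)" for t
    by (simp add: eq add)
  moreover have "(\<lambda>t. f (\<phi> t) + c) \<in> BPC \<theta>"
    using \<phi> BPC_affine[OF f] by (simp add: asymptotically_unpredictable_def)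
  moreover have "\<exists>p \<omega>. p \<ge> 1 \<and> \<omega> > 0 \<and> \<theta> \<in> periodic_seqs p \<omega>"
    using \<phi> by (simp add: asymptotically_unpredictable_def)
  ultimately show ?thesis
    unfolding asymptotically_unpredictable_def
    by (intro conjI exI[of _ "\<lambda>t. f (\<psi> t) + c"] exI[of _ "\<lambda>t. f (\<xi> t)"]) simp_all
qed

theorem lemma2p1:
  fixes p :: nat and \<omega> :: real and \<theta> :: "int \<Rightarrow> real" and \<phi> :: "real \<Rightarrow> real ^ 'm"
    and c :: "real ^ 'm" and \<Omega> :: "real ^ 'm ^ 'm"
  assumes "p \<ge> 1" and "\<omega> > 0" and "\<theta> \<in> periodic_seqs p \<omega>"
    and "\<phi> \<in> BPC \<theta>" and "asymptotically_unpredictable \<theta> \<phi>"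
    and "invertible \<Omega>"
  shows "(\<lambda>t. \<Omega> *v \<phi> t + c) \<in> BPC \<theta> \<and>
         asymptotically_unpredictable \<theta> (\<lambda>t. \<Omega> *v \<phi> t + c)"
proof
  have "inj ((*v) \<Omega>)"
    using \<open>invertible \<Omega>\<close> by (rule inj_matrix_vector_mult)
  then show "asymptotically_unpredictable \<theta> (\<lambda>t. \<Omega> *v \<phi> t + c)"
    using assms(5) by (intro asymptotically_unpredictable_affine) auto
  show "(\<lambda>t. \<Omega> *v \<phi> t + c) \<in> BPC \<theta>"
    using assms(4) by (intro BPC_affine) auto
qed

end
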